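(* Let $X$ be a Banach space. Then $\mathrm{Ip}(\Sigma\ell_\infty(X))=\ell_{1,w}(X)$ as vector spaces, and their norms coincide: $\|s\|_{\mathrm{Ip}(\Sigma\ell_\infty(X))}=\|s\|_{\ell_{1,w}(X)}$ for every $s$ in this space.
   Context: $\mathbb K=\mathbb R$ or $\mathbb C$; $S(X)$ is the space of all sequences in $X$. $\Sigma\ell_\infty(X)$ is the space of sequences $s\in S(X)$ with bounded partial sums, with norm $\|s\|=\sup_m\|\sum_{n=1}^m s(n)\|$. Its $b$-ideal part is $\mathrm{Ip}(\Sigma\ell_\infty(X)):=\{s\in S(X): t\cdot s\in\Sigma\ell_\infty(X)\ \forall t\in\ell_\infty(\mathbb K)\}$, where $(t\cdot s)(n)=t(n)s(n)$, with norm $\|s\|_{\mathrm{Ip}(\Sigma\ell_\infty(X))}=\sup\{\|\sum_{n=1}^m t(n)s(n)\|:t\in\ell_\infty(\mathbb K),\ \|t\|_\infty\le1,\ m\in\mathbb N\}$. $\ell_{1,w}(X):=\{s\in S(X):\sum_{n}|\langle s(n),x^*\rangle|<\infty\ \forall x^*\in X^*\}$, with norm $\|s\|_{\ell_{1,w}(X)}=\sup\{\sum_{n=1}^\infty|\langle s(n),x^*\rangle|:x^*\in X^*,\ \|x^*\|\le1\}$. *)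

theory Defs
  imports "HOL-Analysis.Analysis" "HOL-Library.Function_Algebras"
begin

text \<open>
  Normed spaces over a scalar field \<open>'k\<close> (used for \<open>real\<close> and \<open>complex\<close>). The library only knows
  real normed spaces, so such a space is a real normed space with a compatible multiplication
  by scalars from \<open>'k\<close>. It is a Banach space if the underlying real space is of class \<open>banach\<close>.
\<close>

locale normed_space_over = vector_space smul
  for smul :: "'k::real_normed_field \<Rightarrow> 'x::real_normed_vector \<Rightarrow> 'x" +
  assumes scale_of_real: "smul (of_real r) x = r *\<^sub>R x"
    and norm_scale: "norm (smul c x) = norm c * norm x"

lemma normed_space_over_scaleR:
  "normed_space_over ((*\<^sub>R) :: real \<Rightarrow> 'x::real_normed_vector \<Rightarrow> 'x)"
  by unfold_locales (simp_all add: algebra_simps)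

lemma normed_space_over_complex: "normed_space_over ((*) :: complex \<Rightarrow> complex \<Rightarrow> complex)"
  by unfold_locales (simp_all add: algebra_simps norm_mult scaleR_conv_of_real)

definition dual :: "('k::real_normed_field \<Rightarrow> 'x::real_normed_vector \<Rightarrow> 'x) \<Rightarrow> ('x \<Rightarrow> 'k) set" where
  "dual smul = {f. Vector_Spaces.linear smul (*) f \<and> bounded_linear f}"

text \<open>
  Sequences are indexed from 0, so that \<open>s n\<close> stands for the term with index \<open>n + 1\<close> of the usual
  1-based notation, and \<open>\<Sum>n\<le>m\<close> runs over the nonempty partial sums.
\<close>

definition linf :: "(nat \<Rightarrow> 'k::real_normed_field) set" where
  "linf = {t. bounded (range t)}"

definition norm_linf :: "(nat \<Rightarrow> 'k::real_normed_field) \<Rightarrow> real" where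
  "norm_linf t = (SUP n. norm (t n))"

definition Sigma_linf :: "(nat \<Rightarrow> 'x::real_normed_vector) set" where
  "Sigma_linf = {s. bounded (range (\<lambda>m. \<Sum>n\<le>m. s n))}"

definition Ip :: "('k::real_normed_field \<Rightarrow> 'x::real_normed_vector \<Rightarrow> 'x)
    \<Rightarrow> (nat \<Rightarrow> 'x) set \<Rightarrow> (nat \<Rightarrow> 'x) set" where
  "Ip smul Z = {s. \<forall>t\<in>linf. (\<lambda>n. smul (t n) (s n)) \<in> Z}"

text \<open>
  The norms are suprema in \<open>[0,\<infinity>]\<close>, because the supremum of an unbounded set of reals is an
  unspecified real number.
\<close>

definition norm_Ip_Sigma_linf :: "('k::real_normed_field \<Rightarrow> 'x::real_normed_vector \<Rightarrow> 'x)
    \<Rightarrow> (nat \<Rightarrow> 'x) \<Rightarrow> ennreal" where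
  "norm_Ip_Sigma_linf smul s =
     (SUP (t, m) \<in> {t \<in> linf. norm_linf t \<le> 1} \<times> UNIV.
        ennreal (norm (\<Sum>n\<le>m. smul (t n) (s n))))"

definition l1w :: "('k::real_normed_field \<Rightarrow> 'x::real_normed_vector \<Rightarrow> 'x) \<Rightarrow> (nat \<Rightarrow> 'x) set" where
  "l1w smul = {s. \<forall>f\<in>dual smul. summable (\<lambda>n. norm (f (s n)))}"

definition norm_l1w :: "('k::real_normed_field \<Rightarrow> 'x::real_normed_vector \<Rightarrow> 'x)
    \<Rightarrow> (nat \<Rightarrow> 'x) \<Rightarrow> ennreal" where
  "norm_l1w smul s =
     (SUP f \<in> {f \<in> dual smul. onorm f \<le> 1}. \<Sum>n. ennreal (norm (f (s n))))"

definition seq_scale :: "('k \<Rightarrow> 'x \<Rightarrow> 'x) \<Rightarrow> 'k \<Rightarrow> (nat \<Rightarrow> 'x) \<Rightarrow> (nat \<Rightarrow> 'x)" where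
  "seq_scale smul c s = (\<lambda>n. smul c (s n))"

text \<open>Makes \<open>module.subspace (seq_scale smul)\<close> meaningful, with pointwise addition of sequences.\<close>

lemma (in normed_space_over) module_seq_scale: "module (seq_scale smul)"
  by unfold_locales
    (auto simp: seq_scale_def fun_eq_iff scale_right_distrib scale_left_distrib)

end

(* Applying f to the sum of t(n) s(n), where t(n) rotates f(s(n)) onto the positive axis, bounds the
   partial sums of |f(s(n))|; conversely |f(sum t(n) s(n))| <= sum |f(s(n))| for every f, and a norming
   functional f recovers the norm of the sum. So the two suprema agree by Hahn-Banach. They are finite
   on l1w because the set of all these sums is weakly bounded, hence bounded by the Baire category
   theorem in the dual. *)

theory Submission
  imports Defs
begin

section \<open>Hahn--Banach via minimal sublinear functionals\<close>

definition sublinear :: "('a::real_vector \<Rightarrow> real) \<Rightarrow> bool" where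
  "sublinear p \<longleftrightarrow> (\<forall>x y. p (x + y) \<le> p x + p y) \<and> (\<forall>c x. 0 \<le> c \<longrightarrow> p (c *\<^sub>R x) = c * p x)"

lemma sublinear_add: "sublinear p \<Longrightarrow> p (x + y) \<le> p x + p y"
  by (simp add: sublinear_def)

lemma sublinear_scaleR: "sublinear p \<Longrightarrow> 0 \<le> c \<Longrightarrow> p (c *\<^sub>R x) = c * p x"
  by (simp add: sublinear_def)

lemma sublinear_0: "sublinear p \<Longrightarrow> p 0 = 0"
  using sublinear_scaleR[of p 0 0] by simp

lemma sublinear_minus: "sublinear p \<Longrightarrow> - p (- x) \<le> p x"
  using sublinear_add[of p x "- x"] by (simp add: sublinear_0)

lemma sublinear_norm: "sublinear (norm :: 'a::real_normed_vector \<Rightarrow> real)"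
  by (simp add: sublinear_def norm_triangle_ineq)

text \<open>The inequality for \<open>inverse c\<close> at the point \<open>c *\<^sub>R x\<close> is
  the reverse one for \<open>c\<close> at \<open>x\<close>, so one half of homogeneity suffices.
  This suits functionals defined as infima.\<close>

lemma sublinearI:
  assumes add: "\<And>x y. p (x + y) \<le> p x + p y"
    and zero: "p 0 = 0"
    and le: "\<And>c x. 0 < c \<Longrightarrow> p (c *\<^sub>R x) \<le> c * p x"
  shows "sublinear p"
  unfolding sublinear_def
proof (intro conjI allI impI)
  fix c :: real and x assume "0 \<le> c"
  show "p (c *\<^sub>R x) = c * p x"
  proof (cases "c = 0")
    case False
    with \<open>0 \<le> c\<close> have c: "0 < c" by simp
    have "p x \<le> inverse c * p (c *\<^sub>R x)"
      using le[of "inverse c" "c *\<^sub>R x"] c by simp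
    then have "c * p x \<le> p (c *\<^sub>R x)"
      using c by (simp add: field_simps)
    with le[OF c, of x] show ?thesis by simp
  qed (simp add: zero)
qed (rule add)

text \<open>Zorn's lemma for the reversed pointwise order: the infimum of a nonempty chain of
  sublinear functionals is again sublinear.\<close>

lemma minimal_sublinear_exists:
  assumes q: "sublinear q"
  obtains p where "sublinear p" "p \<le> q" "\<And>r. sublinear r \<Longrightarrow> r \<le> p \<Longrightarrow> r = p"
proof -
  define A where "A = {p. sublinear p \<and> p \<le> q}"
  let ?P = "\<lambda>a b. b \<le> (a :: 'a \<Rightarrow> real)"
  have "\<exists>m\<in>A. \<forall>a\<in>A. ?P m a \<longrightarrow> a = m"
  proof (rule predicate_Zorn)
    show "partial_order_on A (relation_of ?P A)"
      by (rule partial_order_on_relation_ofI) auto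
  next
    fix C assume C: "C \<in> Chains (relation_of ?P A)"
    show "\<exists>u\<in>A. \<forall>a\<in>C. ?P a u"
    proof (cases "C = {}")
      case True
      then show ?thesis using q by (auto simp: A_def)
    next
      case False
      have CA: "C \<subseteq> A" and chain: "\<And>a b. a \<in> C \<Longrightarrow> b \<in> C \<Longrightarrow> a \<le> b \<or> b \<le> a"
        using C by (auto simp: Chains_def relation_of_def)
      then have sub: "sublinear p" and le_q: "p x \<le> q x" if "p \<in> C" for p x
        using that by (auto simp: A_def le_fun_def)
      define u where "u = (\<lambda>x. INF p\<in>C. p x)"
      \<comment> \<open>This lower bound is uniform in \<open>p\<close>, so the real infimum in
        \<open>u\<close> is a genuine one.\<close>
      have "- q (- x) \<le> p x" if "p \<in> C" for p x
        using sublinear_minus[OF sub[OF that], of x] le_q[OF that, of "- x"] by linarith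
      then have bdd: "bdd_below ((\<lambda>p. p x) ` C)" for x
        by (intro bdd_belowI2)
      have u_le: "u x \<le> p x" if "p \<in> C" for p x
        unfolding u_def by (rule cINF_lower[OF bdd that])
      have u_greatest: "z \<le> u x" if "\<And>p. p \<in> C \<Longrightarrow> z \<le> p x" for z x
        unfolding u_def using False that by (rule cINF_greatest)
      have "sublinear u"
      proof (rule sublinearI)
        fix x y
        \<comment> \<open>The smaller of the comparable functionals \<open>p1\<close> and
          \<open>p2\<close> serves at both points. The infimum is then taken over \<open>p2\<close>
          and afterwards over \<open>p1\<close>.\<close>
        have "u (x + y) \<le> p1 x + p2 y" if p: "p1 \<in> C" "p2 \<in> C" for p1 p2
        proof -
          obtain p where "p \<in> C" "p x \<le> p1 x" "p y \<le> p2 y"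
            using chain[OF p] p by (auto simp: le_fun_def)
          then show ?thesis
            using u_le[of p "x + y"] sublinear_add[OF sub[of p], of x y] by linarith
        qed
        then have "u (x + y) - p1 x \<le> u y" if "p1 \<in> C" for p1
          by (intro u_greatest) (use that in \<open>smt (verit)\<close>)
        then have "u (x + y) - u y \<le> u x"
          by (intro u_greatest) (smt (verit))
        then show "u (x + y) \<le> u x + u y" by simp
      next
        show "u 0 = 0"
          unfolding u_def using False by (simp add: sublinear_0 sub cong: INF_cong)
      next
        fix c :: real and x assume c: "0 < c"
        have "u (c *\<^sub>R x) / c \<le> u x"
        proof (rule u_greatest)
          fix p assume "p \<in> C"
          then show "u (c *\<^sub>R x) / c \<le> p x"
            using u_le[of p "c *\<^sub>R x"] c by (simp add: sublinear_scaleR sub field_simps)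
        qed
        then show "u (c *\<^sub>R x) \<le> c * u x"
          using c by (simp add: field_simps)
      qed
      moreover have "u \<le> q"
        using False u_le le_q unfolding le_fun_def by (meson all_not_in_conv order_trans)
      ultimately show ?thesis
        using u_le by (auto simp: A_def le_fun_def)
    qed
  qed
  then show ?thesis
    using that unfolding A_def by (metis (mono_tags, lifting) mem_Collect_eq order_trans)
qed

text \<open>For sublinear \<open>p\<close> this is a sublinear functional below \<open>p\<close>
  with value at most \<open>- p y\<close> at \<open>- y\<close>. Comparing it with a minimal
  \<open>p\<close> yields additivity.\<close>

definition tilt :: "('a::real_vector \<Rightarrow> real) \<Rightarrow> 'a \<Rightarrow> 'a \<Rightarrow> real" where
  "tilt p y x = (INF t\<in>{0..}. p (x + t *\<^sub>R y) - t * p y)"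

lemma tilt_le:
  assumes p: "sublinear p" and "0 \<le> t"
  shows "tilt p y x \<le> p (x + t *\<^sub>R y) - t * p y"
  unfolding tilt_def
proof (rule cINF_lower)
  show "bdd_below ((\<lambda>t. p (x + t *\<^sub>R y) - t * p y) ` {0..})"
  proof (rule bdd_belowI2)
    fix t :: real assume "t \<in> {0..}"
    \<comment> \<open>Subadditivity bounds \<open>p (t *\<^sub>R y) = t * p y\<close>, so
      \<open>t\<close> cancels and the lower bound is uniform in it.\<close>
    then show "- p (- x) \<le> p (x + t *\<^sub>R y) - t * p y"
      using sublinear_add[OF p, of "x + t *\<^sub>R y" "- x"] by (simp add: sublinear_scaleR[OF p])
  qed
qed (use assms in simp)

lemma le_tilt: "(\<And>t. 0 \<le> t \<Longrightarrow> z \<le> p (x + t *\<^sub>R y) - t * p y) \<Longrightarrow> z \<le> tilt p y x"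
  unfolding tilt_def by (rule cINF_greatest) auto

text \<open>Parameters \<open>t\<close> for \<open>x\<close> and \<open>u\<close> for
  \<open>x'\<close> combine to \<open>t + u\<close> for the sum; scaling \<open>x\<close> by
  \<open>c\<close> turns the parameter \<open>t\<close> into \<open>c * t\<close>.\<close>

lemma sublinear_tilt:
  assumes p: "sublinear p"
  shows "sublinear (tilt p y)"
proof (rule sublinearI)
  fix x x'
  have "tilt p y (x + x') \<le> (p (x + t *\<^sub>R y) - t * p y) + (p (x' + u *\<^sub>R y) - u * p y)"
    if "0 \<le> t" "0 \<le> u" for t u
    using tilt_le[OF p, of "t + u" y "x + x'"] that
      sublinear_add[OF p, of "x + t *\<^sub>R y" "x' + u *\<^sub>R y"]
    by (simp add: algebra_simps)
  then have "tilt p y (x + x') - (p (x + t *\<^sub>R y) - t * p y) \<le> tilt p y x'" if "0 \<le> t" for t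
    using that by (intro le_tilt) (smt (verit))
  then have "tilt p y (x + x') - tilt p y x' \<le> tilt p y x"
    by (intro le_tilt) (smt (verit))
  then show "tilt p y (x + x') \<le> tilt p y x + tilt p y x'" by simp
next
  show "tilt p y 0 = 0"
    using tilt_le[OF p, of 0 y 0] le_tilt[of 0 p 0 y]
    by (simp add: sublinear_0[OF p] sublinear_scaleR[OF p])
next
  fix c :: real and x assume c: "0 < c"
  have "tilt p y (c *\<^sub>R x) / c \<le> tilt p y x"
  proof (rule le_tilt)
    fix t :: real assume t: "0 \<le> t"
    have "tilt p y (c *\<^sub>R x) \<le> p (c *\<^sub>R (x + t *\<^sub>R y)) - c * t * p y"
      using tilt_le[OF p, of "c * t" y "c *\<^sub>R x"] c t by (simp add: scaleR_add_right)
    also have "\<dots> = c * (p (x + t *\<^sub>R y) - t * p y)"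
      using c by (simp add: sublinear_scaleR[OF p] algebra_simps del: scaleR_add_right)
    finally show "tilt p y (c *\<^sub>R x) / c \<le> p (x + t *\<^sub>R y) - t * p y"
      using c by (simp add: field_simps)
  qed
  then show "tilt p y (c *\<^sub>R x) \<le> c * tilt p y x"
    using c by (simp add: field_simps)
qed

lemma tilt_le_self: "sublinear p \<Longrightarrow> tilt p y \<le> p"
  using tilt_le[of p 0 y] by (simp add: le_fun_def)

text \<open>By minimality \<open>tilt p y = p\<close>. The parameter 1 then gives superadditivity,
  and additivity makes \<open>p\<close> odd, which settles negative scalars.\<close>

lemma minimal_sublinear_linear:
  assumes p: "sublinear p" and min: "\<And>r. sublinear r \<Longrightarrow> r \<le> p \<Longrightarrow> r = p"
  shows "linear p"
proof -
  have "tilt p y = p" for y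
    using min sublinear_tilt[OF p] tilt_le_self[OF p] .
  then have "p x + p y \<le> p (x + y)" for x y
    using tilt_le[OF p, of 1 y x] by simp
  with sublinear_add[OF p] have add: "p (x + y) = p x + p y" for x y
    by (rule antisym)
  have neg: "p (- x) = - p x" for x
    using add[of x "- x"] by (simp add: sublinear_0[OF p])
  have "p (c *\<^sub>R x) = c * p x" for c x
    using sublinear_scaleR[OF p, of c x] sublinear_scaleR[OF p, of "- c" x] neg[of "c *\<^sub>R x"]
    by (cases "0 \<le> c") simp_all
  with add show ?thesis by (intro linearI) simp_all
qed

text \<open>Tilting the norm along \<^term>\<open>x\<close> beforehand forces the minimal functional to attain
  \<^term>\<open>norm x\<close> at \<^term>\<open>x\<close>.\<close>

theorem Hahn_Banach_norming:
  fixes x :: "'a::real_normed_vector"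
  obtains f :: "'a \<Rightarrow>\<^sub>L real" where "norm f \<le> 1" "f x = norm x"
proof -
  obtain p where p: "sublinear p" "p \<le> tilt norm x"
    and min: "\<And>r. sublinear r \<Longrightarrow> r \<le> p \<Longrightarrow> r = p"
    using minimal_sublinear_exists[OF sublinear_tilt[OF sublinear_norm]] by blast
  interpret p: linear p
    using p(1) min by (rule minimal_sublinear_linear)
  have le: "p z \<le> norm z" for z
    using p(2) tilt_le_self[OF sublinear_norm, of x] by (meson le_funD order_trans)
  have abs: "\<bar>p z\<bar> \<le> 1 * norm z" for z
    using le[of z] le[of "- z"] by (simp add: p.neg abs_le_iff)
  then have bl: "bounded_linear p"
    by (intro bounded_linear_intro[of _ 1] p.add p.scale) simp
  show ?thesis
  proof
    show "norm (Blinfun p) \<le> 1"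
      by (rule norm_blinfun_bound) (use abs in \<open>simp_all add: bounded_linear_Blinfun_apply[OF bl]\<close>)
    \<comment> \<open>The parameter 1 makes the first term \<open>norm (- x + x)\<close> vanish, so
      \<open>- p x\<close> is at most \<open>- norm x\<close>; \<open>le\<close> gives the other
      direction.\<close>
    have "p (- x) \<le> tilt norm x (- x)"
      using p(2) by (rule le_funD)
    also have "\<dots> \<le> - norm x"
      using tilt_le[OF sublinear_norm, of 1 x "- x"] by simp
    finally show "Blinfun p x = norm x"
      using le[of x] by (simp add: p.neg bounded_linear_Blinfun_apply[OF bl])
  qed
qed

section \<open>Weakly bounded sets are bounded\<close>

text \<open>Uniform boundedness on the real dual, which is complete: the closed sets
  \<open>F k\<close> cover it, so one of them contains a ball.\<close>

lemma weakly_bounded_imp_bounded: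
  fixes A :: "'a::real_normed_vector set"
  assumes wb: "\<And>f :: 'a \<Rightarrow>\<^sub>L real. bounded (blinfun_apply f ` A)"
  shows "bounded A"
proof -
  define F where "F k = {f :: 'a \<Rightarrow>\<^sub>L real. \<forall>a\<in>A. \<bar>f a\<bar> \<le> real k}" for k
  have F_eq: "F k = (\<Inter>a\<in>A. {f. \<bar>blinfun_apply f a\<bar> \<le> real k})" for k
    by (auto simp: F_def)
  have closed: "closed (F k)" for k
    unfolding F_eq by (intro closed_INT ballI closed_Collect_le continuous_intros)
  have cover: "(\<Union>k. F k) = UNIV"
  proof -
    have "\<exists>k. f \<in> F k" for f
    proof -
      obtain B where "\<And>a. a \<in> A \<Longrightarrow> \<bar>f a\<bar> \<le> B"
        using wb[of f] by (auto simp: bounded_iff)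
      moreover obtain k where "B \<le> real k" using real_arch_simple by blast
      ultimately have "f \<in> F k" by (force simp: F_def)
      then show ?thesis ..
    qed
    then show ?thesis by blast
  qed
  have "\<exists>k. interior (F k) \<noteq> {}"
  proof (rule ccontr)
    assume "\<not> (\<exists>k. interior (F k) \<noteq> {})"
    then have "euclidean interior_of \<Union> (range F) = {}"
      by (intro Baire_category_alt) (auto simp: completely_metrizable_space_euclidean closed)
    then show False using cover by simp
  qed
  then obtain k f where "f \<in> interior (F k)" by auto
  then obtain e where e: "0 < e" "cball f e \<subseteq> F k"
    by (auto simp: mem_interior_cball)
  have "norm a \<le> 2 * real k / e" if a: "a \<in> A" for a
  proof -
    obtain g :: "'a \<Rightarrow>\<^sub>L real" where g: "norm g \<le> 1" "g a = norm a"
      by (rule Hahn_Banach_norming)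
    \<comment> \<open>Both the centre and its shift by \<open>e *\<^sub>R g\<close> lie in the ball,
      and at \<open>a\<close> they differ by \<open>e * norm a\<close>.\<close>
    have "f \<in> F k" "f + e *\<^sub>R g \<in> F k"
      using e g(1) by (auto intro!: subsetD[OF e(2)] simp: dist_norm)
    with a have "\<bar>f a\<bar> \<le> real k" "\<bar>f a + e * norm a\<bar> \<le> real k"
      by (auto simp: F_def blinfun.add_left blinfun.scaleR_left g(2))
    then have "e * norm a \<le> 2 * real k" by linarith
    with e(1) show ?thesis by (simp add: field_simps)
  qed
  then show ?thesis by (auto simp: bounded_iff)
qed


section \<open>The two sequence spaces\<close>

text \<open>The real supremum in \<open>norm_linf\<close> dominates the terms only for a bounded
  sequence, so membership in \<open>linf\<close> belongs to the equivalence.\<close>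

lemma linf_norm_linf_le_1_iff: "t \<in> linf \<and> norm_linf t \<le> 1 \<longleftrightarrow> (\<forall>n. norm (t n) \<le> 1)"
proof
  assume t: "t \<in> linf \<and> norm_linf t \<le> 1"
  then have "bdd_above (range (\<lambda>n. norm (t n)))"
    by (auto simp: linf_def bounded_iff bdd_above_def)
  then have "norm (t n) \<le> norm_linf t" for n
    unfolding norm_linf_def by (intro cSUP_upper) simp_all
  with t show "\<forall>n. norm (t n) \<le> 1" by (meson order_trans)
next
  assume "\<forall>n. norm (t n) \<le> 1"
  then show "t \<in> linf \<and> norm_linf t \<le> 1"
    by (auto simp: linf_def norm_linf_def bounded_iff intro!: cSUP_least)
qed

lemma norm_Ip_Sigma_linf_eq:
  "norm_Ip_Sigma_linf smul s =
    (SUP (t, m) \<in> {t. \<forall>n. norm (t n) \<le> 1} \<times> UNIV. ennreal (norm (\<Sum>n\<le>m. smul (t n) (s n))))"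
  unfolding norm_Ip_Sigma_linf_def by (simp add: linf_norm_linf_le_1_iff)

section \<open>Multipliers and functionals over a general scalar field\<close>

context normed_space_over
begin

lemma dual_bounded_linear: "f \<in> dual smul \<Longrightarrow> bounded_linear f"
  by (simp add: dual_def)

lemma dual_smul: "f \<in> dual smul \<Longrightarrow> f (smul c x) = c * f x"
  by (simp add: dual_def Vector_Spaces.linear_iff)

lemma dual_sum_smul:
  assumes "f \<in> dual smul"
  shows "f (\<Sum>n\<in>A. smul (t n) (s n)) = (\<Sum>n\<in>A. t n * f (s n))"
  using bounded_linear.linear[OF dual_bounded_linear[OF assms]]
  by (simp add: linear_sum dual_smul[OF assms])

text \<open>Each \<open>t n\<close> rotates \<open>f (s n)\<close> onto the nonnegative axis. One
  sequence \<open>t\<close> serves all index sets \<open>A\<close>, hence all partial sums at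
  once.\<close>

lemma sum_norm_dual_eq:
  assumes f: "f \<in> dual smul"
  obtains t where "\<And>n. norm (t n) \<le> 1"
    "\<And>A. (\<Sum>n\<in>A. norm (f (s n))) = norm (f (\<Sum>n\<in>A. smul (t n) (s n)))"
proof
  \<comment> \<open>If \<^term>\<open>f (s n) = 0\<close>, division by zero gives \<^term>\<open>t n = 0\<close>.\<close>
  define t where "t n = of_real (norm (f (s n))) / f (s n)" for n
  show "norm (t n) \<le> 1" for n
    by (simp add: t_def norm_divide)
  have "t n * f (s n) = of_real (norm (f (s n)))" for n
    by (simp add: t_def)
  then have eq: "f (\<Sum>n\<in>A. smul (t n) (s n)) = of_real (\<Sum>n\<in>A. norm (f (s n)))" for A
    by (simp add: dual_sum_smul[OF f])
  then show "(\<Sum>n\<in>A. norm (f (s n))) = norm (f (\<Sum>n\<in>A. smul (t n) (s n)))" for A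
    unfolding eq norm_of_real by (simp add: sum_nonneg)
qed

text \<open>A general \<open>C\<close> covers every bounded multiplier, as membership in
  \<open>Ip\<close> requires; \<open>C = 1\<close> serves the norms.\<close>

lemma norm_dual_sum_le:
  assumes f: "f \<in> dual smul" and t: "\<And>n. norm (t n) \<le> C"
  shows "norm (f (\<Sum>n\<in>A. smul (t n) (s n))) \<le> C * (\<Sum>n\<in>A. norm (f (s n)))"
proof -
  have "norm (f (\<Sum>n\<in>A. smul (t n) (s n))) \<le> (\<Sum>n\<in>A. norm (t n * f (s n)))"
    unfolding dual_sum_smul[OF f] by (rule norm_sum)
  also have "\<dots> \<le> (\<Sum>n\<in>A. C * norm (f (s n)))"
    by (intro sum_mono) (simp add: norm_mult mult_right_mono t)
  finally show ?thesis by (simp add: sum_distrib_left)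
qed

lemma subspace_l1w: "module.subspace (seq_scale smul) (l1w smul)"
proof -
  interpret m: module "seq_scale smul" by (rule module_seq_scale)
  show ?thesis
  proof (rule m.subspaceI)
    show "0 \<in> l1w smul"
      by (auto simp: l1w_def dest!: dual_bounded_linear bounded_linear.linear linear_0)
  next
    fix s s' assume s: "s \<in> l1w smul" "s' \<in> l1w smul"
    show "s + s' \<in> l1w smul"
      unfolding l1w_def
    proof (intro CollectI ballI)
      fix f assume f: "f \<in> dual smul"
      then have "summable (\<lambda>n. norm (f (s n)) + norm (f (s' n)))"
        using s by (auto simp: l1w_def intro: summable_add)
      then show "summable (\<lambda>n. norm (f ((s + s') n)))"
        by (rule summable_comparison_test'[where N = 0])
          (simp add: linear_add[OF bounded_linear.linear[OF dual_bounded_linear[OF f]]]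
            norm_triangle_ineq)
    qed
  next
    fix c s assume "s \<in> l1w smul"
    then show "seq_scale smul c s \<in> l1w smul"
      by (auto simp: l1w_def seq_scale_def dual_smul norm_mult intro: summable_mult)
  qed
qed

text \<open>For the rotating multiplier \<open>t\<close>, the images under \<open>f\<close> of the
  bounded partial sums have as norms the partial sums of \<open>norm (f (s n))\<close>.\<close>

lemma Ip_Sigma_linf_subset_l1w: "Ip smul Sigma_linf \<subseteq> l1w smul"
proof
  fix s assume s: "s \<in> Ip smul Sigma_linf"
  show "s \<in> l1w smul"
    unfolding l1w_def
  proof (intro CollectI ballI)
    fix f assume f: "f \<in> dual smul"
    interpret f: bounded_linear f by (rule dual_bounded_linear[OF f])
    obtain t where t: "\<And>n. norm (t n) \<le> 1"
      and eq: "\<And>A. (\<Sum>n\<in>A. norm (f (s n))) = norm (f (\<Sum>n\<in>A. smul (t n) (s n)))"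
      using sum_norm_dual_eq[OF f, of s] by blast
    have "t \<in> linf" using t linf_norm_linf_le_1_iff by blast
    with s have "bounded (range (\<lambda>m. \<Sum>n\<le>m. smul (t n) (s n)))"
      by (simp add: Ip_def Sigma_linf_def)
    then have "bounded (f ` range (\<lambda>m. \<Sum>n\<le>m. smul (t n) (s n)))"
      by (rule bounded_linear_image) (rule f.bounded_linear_axioms)
    then obtain B where "\<And>m. norm (f (\<Sum>n\<le>m. smul (t n) (s n))) \<le> B"
      by (auto simp: bounded_iff)
    then show "summable (\<lambda>n. norm (f (s n)))"
      by (intro bounded_imp_summable[of _ B]) (simp_all add: eq)
  qed
qed

end

text \<open>For complex scalars the assumption is satisfied by the complexification
  \<open>f x = g x - \<i> g (\<i> x)\<close> of \<open>g\<close>; it reduces everything to real functionals.\<close>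

locale dual_dominates_real = normed_space_over +
  assumes dominate: "\<And>g :: 'b \<Rightarrow> real. bounded_linear g \<Longrightarrow>
    \<exists>f\<in>dual smul. onorm f \<le> onorm g \<and> (\<forall>x. \<bar>g x\<bar> \<le> norm (f x))"
begin

text \<open>Replacing a real norming functional by a dominating \<open>f\<close> keeps it in the
  unit ball and can only enlarge its modulus at \<open>x\<close>.\<close>

lemma dual_norming:
  obtains f where "f \<in> dual smul" "onorm f \<le> 1" "norm x \<le> norm (f x)"
proof -
  obtain g :: "'b \<Rightarrow>\<^sub>L real" where g: "norm g \<le> 1" "g x = norm x"
    by (rule Hahn_Banach_norming)
  obtain f where f: "f \<in> dual smul" "onorm f \<le> onorm g" "\<And>x. \<bar>g x\<bar> \<le> norm (f x)"
    using dominate[OF blinfun.bounded_linear_right[of g]] by blast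
  have "norm x \<le> norm (f x)"
    using f(3)[of x] g(2) by simp
  moreover have "onorm f \<le> 1"
    using f(2) g(1) by (simp add: norm_blinfun.rep_eq)
  ultimately show ?thesis using that f(1) by blast
qed

text \<open>Uniformity in \<open>t\<close> and \<open>m\<close> lets this serve both membership in
  \<open>Ip\<close> and finiteness of the norm. Weak boundedness is tested on real functionals, each
  dominated by some \<open>f\<close> in the dual.\<close>

lemma bounded_l1w_multiplier_sums:
  assumes s: "s \<in> l1w smul"
  shows "bounded {\<Sum>n\<le>m. smul (t n) (s n) | t m. \<forall>n. norm (t n) \<le> C}" (is "bounded ?A")
proof (rule weakly_bounded_imp_bounded)
  fix g :: "'b \<Rightarrow>\<^sub>L real"
  obtain f where f: "f \<in> dual smul" "\<And>x. \<bar>g x\<bar> \<le> norm (f x)"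
    using dominate[OF blinfun.bounded_linear_right[of g]] by blast
  have summ: "summable (\<lambda>n. norm (f (s n)))"
    using s f(1) by (simp add: l1w_def)
  have "\<bar>g (\<Sum>n\<le>m. smul (t n) (s n))\<bar> \<le> C * (\<Sum>n. norm (f (s n)))"
    if t: "\<forall>n. norm (t n) \<le> C" for t m
  proof -
    have "0 \<le> C" using t norm_ge_zero order_trans by blast
    have "\<bar>g (\<Sum>n\<le>m. smul (t n) (s n))\<bar> \<le> norm (f (\<Sum>n\<le>m. smul (t n) (s n)))"
      by (rule f(2))
    also have "\<dots> \<le> C * (\<Sum>n\<le>m. norm (f (s n)))"
      by (rule norm_dual_sum_le[OF f(1)]) (use t in simp)
    also have "\<dots> \<le> C * (\<Sum>n. norm (f (s n)))"
      using summ \<open>0 \<le> C\<close> by (intro mult_left_mono sum_le_suminf) simp_all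
    finally show ?thesis .
  qed
  then show "bounded (blinfun_apply g ` ?A)"
    by (auto simp: bounded_iff)
qed

lemma Ip_Sigma_linf_eq_l1w: "Ip smul Sigma_linf = l1w smul"
proof
  show "l1w smul \<subseteq> Ip smul Sigma_linf"
  proof
    fix s assume s: "s \<in> l1w smul"
    show "s \<in> Ip smul Sigma_linf"
      unfolding Ip_def Sigma_linf_def
    proof (intro CollectI ballI)
      fix t :: "nat \<Rightarrow> 'a" assume "t \<in> linf"
      then obtain C where "\<forall>n. norm (t n) \<le> C"
        by (auto simp: linf_def bounded_iff)
      then show "bounded (range (\<lambda>m. \<Sum>n\<le>m. smul (t n) (s n)))"
        by (intro bounded_subset[OF bounded_l1w_multiplier_sums[OF s, of C]]) auto
    qed
  qed
qed (rule Ip_Sigma_linf_subset_l1w)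

text \<open>Given \<open>t\<close> and \<open>m\<close>, choose \<open>f\<close> norming the finite
  sum; given \<open>f\<close>, choose the rotating \<open>t\<close>. Values in
  \<open>[0,\<infinity>]\<close> allow an arbitrary \<open>s\<close>.\<close>

lemma norm_Ip_Sigma_linf_eq_norm_l1w: "norm_Ip_Sigma_linf smul s = norm_l1w smul s"
proof (rule antisym)
  show "norm_Ip_Sigma_linf smul s \<le> norm_l1w smul s"
    unfolding norm_Ip_Sigma_linf_eq
  proof (rule SUP_least, clarify)
    fix t :: "nat \<Rightarrow> 'a" and m assume t: "\<forall>n. norm (t n) \<le> 1"
    obtain f where f: "f \<in> dual smul" "onorm f \<le> 1"
      and le: "norm (\<Sum>n\<le>m. smul (t n) (s n)) \<le> norm (f (\<Sum>n\<le>m. smul (t n) (s n)))"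
      by (rule dual_norming)
    have "norm (\<Sum>n\<le>m. smul (t n) (s n)) \<le> (\<Sum>n\<le>m. norm (f (s n)))"
      using le norm_dual_sum_le[OF f(1), of t 1 s "{..m}"] t by simp
    then have "ennreal (norm (\<Sum>n\<le>m. smul (t n) (s n))) \<le> (\<Sum>n\<le>m. ennreal (norm (f (s n))))"
      by (simp add: ennreal_leI)
    also have "\<dots> \<le> (\<Sum>n. ennreal (norm (f (s n))))"
      by (rule sum_le_suminf) simp_all
    also have "\<dots> \<le> norm_l1w smul s"
      unfolding norm_l1w_def using f by (intro SUP_upper) simp
    finally show "ennreal (norm (\<Sum>n\<le>m. smul (t n) (s n))) \<le> norm_l1w smul s" .
  qed
next
  show "norm_l1w smul s \<le> norm_Ip_Sigma_linf smul s"
    unfolding norm_l1w_def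
  proof (rule SUP_least, clarify)
    fix f assume f: "f \<in> dual smul" "onorm f \<le> 1"
    obtain t where t: "\<And>n. norm (t n) \<le> 1"
      and eq: "\<And>A. (\<Sum>n\<in>A. norm (f (s n))) = norm (f (\<Sum>n\<in>A. smul (t n) (s n)))"
      using sum_norm_dual_eq[OF f(1), of s] by blast
    have "(\<Sum>n<m. ennreal (norm (f (s n)))) \<le> norm_Ip_Sigma_linf smul s" for m
    proof -
      \<comment> \<open>\<open>suminf_eq_SUP\<close> uses sums over \<open>n<m\<close>, the
        multiplier norm sums over \<open>n\<le>m\<close>; one more nonnegative term bridges the
        gap.\<close>
      have "(\<Sum>n<m. norm (f (s n))) \<le> (\<Sum>n\<le>m. norm (f (s n)))"
        by (rule sum_mono2) auto
      also have "\<dots> \<le> onorm f * norm (\<Sum>n\<le>m. smul (t n) (s n))"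
        unfolding eq by (rule onorm[OF dual_bounded_linear[OF f(1)]])
      also have "\<dots> \<le> norm (\<Sum>n\<le>m. smul (t n) (s n))"
        using f(2) by (simp add: mult_left_le_one_le onorm_pos_le[OF dual_bounded_linear[OF f(1)]])
      finally have "(\<Sum>n<m. ennreal (norm (f (s n)))) \<le> ennreal (norm (\<Sum>n\<le>m. smul (t n) (s n)))"
        by (simp add: ennreal_leI)
      also have "\<dots> \<le> norm_Ip_Sigma_linf smul s"
        unfolding norm_Ip_Sigma_linf_eq by (rule SUP_upper2[of "(t, m)"]) (simp_all add: t)
      finally show ?thesis .
    qed
    then show "(\<Sum>n. ennreal (norm (f (s n)))) \<le> norm_Ip_Sigma_linf smul s"
      unfolding suminf_eq_SUP by (intro SUP_least)
  qed
qed

lemma norm_l1w_finite: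
  assumes "s \<in> l1w smul"
  shows "norm_l1w smul s < \<infinity>"
proof -
  obtain B where B: "\<And>t m. \<forall>n. norm (t n) \<le> 1 \<Longrightarrow> norm (\<Sum>n\<le>m. smul (t n) (s n)) \<le> B"
    using bounded_l1w_multiplier_sums[OF assms, of 1] unfolding bounded_iff by blast
  have "norm_l1w smul s \<le> ennreal B"
    unfolding norm_Ip_Sigma_linf_eq_norm_l1w[symmetric] norm_Ip_Sigma_linf_eq
    by (rule SUP_least) (auto intro!: ennreal_leI B)
  then show ?thesis
    by (simp add: le_less_trans)
qed

text \<open>That \<open>Ip\<close> is a subspace is inherited from \<open>l1w\<close> through the
  equality of the two sets.\<close>

lemma Ip_Sigma_linf_isometric_l1w:
  "module.subspace (seq_scale smul) (Ip smul Sigma_linf) \<and>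
   module.subspace (seq_scale smul) (l1w smul) \<and>
   Ip smul Sigma_linf = l1w smul \<and>
   (\<forall>s\<in>l1w smul. norm_Ip_Sigma_linf smul s = norm_l1w smul s \<and> norm_l1w smul s < \<infinity>)"
  by (simp add: Ip_Sigma_linf_eq_l1w subspace_l1w norm_Ip_Sigma_linf_eq_norm_l1w norm_l1w_finite
      del: infinity_ennreal_def)

end

section \<open>Real and complex scalars\<close>

lemma dual_dominates_real_scaleR:
  "dual_dominates_real ((*\<^sub>R) :: real \<Rightarrow> 'x::real_normed_vector \<Rightarrow> 'x)"
proof -
  interpret normed_space_over "(*\<^sub>R) :: real \<Rightarrow> 'x \<Rightarrow> 'x"
    by (rule normed_space_over_scaleR)
  show ?thesis
  proof
    fix g :: "'x \<Rightarrow> real" assume g: "bounded_linear g"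
    then interpret g: bounded_linear g .
    have "Vector_Spaces.linear (*\<^sub>R) (*) g"
      unfolding Vector_Spaces.linear_iff
      by (auto simp: g.add g.scale vector_space_axioms intro!: vector_space.intro simp: algebra_simps)
    with g show "\<exists>f\<in>dual (*\<^sub>R). onorm f \<le> onorm g \<and> (\<forall>x. \<bar>g x\<bar> \<le> norm (f x))"
      by (intro bexI[of _ g]) (simp_all add: dual_def)
  qed
qed

text \<open>Complex linearity and real part \<open>g\<close> force the imaginary part
  \<open>- g (scaleC \<i> x)\<close>. Domination is then the bound of a real part by the
  modulus.\<close>

lemma dual_dominates_real_complex:
  fixes scaleC :: "complex \<Rightarrow> 'x::real_normed_vector \<Rightarrow> 'x"
  assumes "normed_space_over scaleC"
  shows "dual_dominates_real scaleC"
proof -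
  interpret normed_space_over scaleC by (rule assms)
  show ?thesis
  proof
    fix g :: "'x \<Rightarrow> real" assume g: "bounded_linear g"
    then interpret g: bounded_linear g .
    define f where "f x = Complex (g x) (- g (scaleC \<i> x))" for x
    have add: "f (x + y) = f x + f y" for x y
      by (simp add: f_def scale_right_distrib g.add complex_eq_iff)
    \<comment> \<open>As \<open>g\<close> is only real-linear, a complex scalar is split into real
      multiples of \<open>x\<close> and \<open>scaleC \<i> x\<close>.\<close>
    have split: "scaleC c x = Re c *\<^sub>R x + Im c *\<^sub>R scaleC \<i> x" for c x
    proof -
      have "scaleC c x = scaleC (of_real (Re c) + of_real (Im c) * \<i>) x"
        by (simp add: complex_eq mult.commute)
      also have "\<dots> = Re c *\<^sub>R x + Im c *\<^sub>R scaleC \<i> x"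
        unfolding scale_left_distrib scale_scale[symmetric] scale_of_real ..
      finally show ?thesis .
    qed
    have g_scale: "g (scaleC c x) = Re c * g x + Im c * g (scaleC \<i> x)" for c x
      unfolding split[of c x] by (simp add: g.add g.scale)
    have scale: "f (scaleC c x) = c * f x" for c x
      \<comment> \<open>The instance at \<open>\<i> * c\<close> supplies the imaginary part.\<close>
      using g_scale[of c x] g_scale[of "\<i> * c" x] by (simp add: f_def complex_eq_iff)
    have f_norm: "norm (f x) \<le> onorm g * norm x" for x
    proof -
      \<comment> \<open>Rotate \<open>f x\<close> onto the positive real axis, where \<open>f\<close> agrees with \<open>g\<close>.\<close>
      define c where "c = of_real (norm (f x)) / f x"
      have "f (scaleC c x) = of_real (norm (f x))"
        by (simp add: scale c_def)
      then have "norm (f x) = g (scaleC c x)"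
        by (simp add: f_def complex_eq_iff)
      also have "\<dots> \<le> onorm g * norm (scaleC c x)"
        using onorm[OF g, of "scaleC c x"] by simp
      \<comment> \<open>The modulus of \<open>c\<close> is 1, or 0 when \<open>f x = 0\<close>
        because of division by zero.\<close>
      also have "\<dots> \<le> onorm g * norm x"
        using onorm_pos_le[OF g]
        by (intro mult_left_mono) (simp_all add: norm_scale c_def norm_divide)
      finally show ?thesis .
    qed
    have "bounded_linear f"
    proof (rule bounded_linear_intro[of _ "onorm g"])
      show "f (r *\<^sub>R x) = r *\<^sub>R f x" for r x
        using scale[of "of_real r" x] by (simp add: scale_of_real scaleR_conv_of_real)
    qed (simp_all add: add f_norm mult.commute)
    moreover have "Vector_Spaces.linear scaleC (*) f"
      unfolding Vector_Spaces.linear_iff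
      by (auto simp: add scale vector_space_axioms intro!: vector_space.intro simp: algebra_simps)
    ultimately have "f \<in> dual scaleC" by (simp add: dual_def)
    moreover have "onorm f \<le> onorm g"
      by (rule onorm_bound) (simp_all add: onorm_pos_le[OF g] f_norm)
    moreover have "\<bar>g x\<bar> \<le> norm (f x)" for x
      using abs_Re_le_cmod[of "f x"] by (simp add: f_def)
    ultimately show "\<exists>f\<in>dual scaleC. onorm f \<le> onorm g \<and> (\<forall>x. \<bar>g x\<bar> \<le> norm (f x))"
      by blast
  qed
qed

theorem proposition11p2:
  fixes scaleC :: "complex \<Rightarrow> 'c::banach \<Rightarrow> 'c"
  shows
    "(let smul = ((*\<^sub>R) :: real \<Rightarrow> 'r::banach \<Rightarrow> 'r) in
        module.subspace (seq_scale smul) (Ip smul Sigma_linf) \<and>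
        module.subspace (seq_scale smul) (l1w smul) \<and>
        Ip smul Sigma_linf = l1w smul \<and>
        (\<forall>s\<in>l1w smul. norm_Ip_Sigma_linf smul s = norm_l1w smul s \<and> norm_l1w smul s < \<infinity>))
     \<and>
     (normed_space_over scaleC \<longrightarrow>
        module.subspace (seq_scale scaleC) (Ip scaleC Sigma_linf) \<and>
        module.subspace (seq_scale scaleC) (l1w scaleC) \<and>
        Ip scaleC Sigma_linf = l1w scaleC \<and>
        (\<forall>s\<in>l1w scaleC. norm_Ip_Sigma_linf scaleC s = norm_l1w scaleC s \<and> norm_l1w scaleC s < \<infinity>))"
  unfolding Let_def
  by (intro conjI[OF _ impI] dual_dominates_real.Ip_Sigma_linf_isometric_l1w
      dual_dominates_real_scaleR dual_dominates_real_complex)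

end
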